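(* Let $\mathcal{P}$ be a radical parametrization, given together with a fixed representation as described in the context, and let $\mathcal{B}_\mathcal{P}\subset\mathbb{C}^{n+m+r}$ be its incidence variety and $\mathcal{A}_\mathcal{P}\subset\mathbb{C}^{n+m+r}$ its auxiliary variety. Then $\mathcal{B}_\mathcal{P}$ is contained in a unique irreducible component of $\mathcal{A}_\mathcal{P}$.
   Context: Let $\overline{t}=(t_1,\dots,t_n)$. A radical tower over $\mathbb{C}(\overline{t})$ is a tower of fields $\mathbb{F}_0=\mathbb{C}(\overline{t})\subseteq\mathbb{F}_1\subseteq\dots\subseteq\mathbb{F}_m$ with $\mathbb{F}_i=\mathbb{F}_{i-1}(\delta_i)$, where $\delta_i^{e_i}=\alpha_i\in\mathbb{F}_{i-1}$, $e_i\in\mathbb{N}$. A radical parametrization $\mathcal{P}$ is a tuple $\overline{x}=(x_1,\dots,x_r)$ of elements of $\mathbb{F}_m$, with $r>n$, whose Jacobian with respect to $\overline{t}$ (using the unique extensions of the derivations $\partial/\partial t_i$ to $\mathbb{F}_m$) has rank $n$; the $\delta_i$ are realized as analytic functions $\delta_i(\overline{t})$ by fixing values $\delta_i(\overline{t}_0)=a_i$ at some point $\overline{t}_0$ (choice of branches), so that $\overline{x}(\overline{t})$ is well defined. A representation of $\mathcal{P}$ consists of the tower together with polynomials such that $\alpha_1=\alpha_{1N}(\overline{t})/\alpha_{1D}(\overline{t})$, $\alpha_i=\alpha_{iN}(\overline{t},\delta_1,\dots,\delta_{i-1})/\alpha_{iD}(\overline{t},\delta_1,\dots,\delta_{i-1})$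 for $i=2,\dots,m$, and $x_j=x_{jN}(\overline{t},\overline{\delta})/x_{jD}(\overline{t},\overline{\delta})$ for $j=1,\dots,r$, where $\overline{\delta}=(\delta_1,\dots,\delta_m)$. Let $\varphi:\mathbb{C}^n\to\mathbb{C}^{n+m+r}$, $\overline{t}\mapsto(\overline{t},\overline{\delta}(\overline{t}),\overline{x}(\overline{t}))$ (defined where the expressions make sense). The incidence variety is $\mathcal{B}_\mathcal{P}=\overline{\mathrm{Im}(\varphi)}$ (Zariski closure). In $\mathbb{C}[\overline{T},\overline{\Delta},\overline{X},Z]$, with $\overline{T}=(T_1,\dots,T_n)$, $\overline{\Delta}=(\Delta_1,\dots,\Delta_m)$, $\overline{X}=(X_1,\dots,X_r)$, define $E_i=\Delta_i^{e_i}\alpha_{iD}(\overline{T},\Delta_1,\dots,\Delta_{i-1})-\alpha_{iN}(\overline{T},\Delta_1,\dots,\Delta_{i-1})$ ($i=1,\dots,m$), $G_j=X_jx_{jD}(\overline{T},\overline{\Delta})-x_{jN}(\overline{T},\overline{\Delta})$ ($j=1,\dots,r$), and $G_Z=Z\cdot\mathrm{lcm}(x_{1D},\dots,x_{rD},\alpha_{1D},\dots,\alpha_{mD})-1$. The auxiliary variety $\mathcal{A}_\mathcal{P}\subset\mathbb{C}^{n+m+r}$ is the Zariski closure of the projection of the common zero set $V(E_1,\dots,E_m,G_1,\dots,G_r,G_Z)\subset\mathbb{C}^{n+m+r+1}$ forgetting the last coordinate $Z$. *)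

theory Defs
  imports "HOL-Analysis.Analysis"
begin

text \<open>A point of C^N is represented as a function nat => complex vanishing at all
  indices >= N. Coordinates are 0-indexed.\<close>

definition cspace :: "nat \<Rightarrow> (nat \<Rightarrow> complex) set" where
  "cspace N = {p. \<forall>i\<ge>N. p i = 0}"

inductive_set mpoly :: "nat \<Rightarrow> ((nat \<Rightarrow> complex) \<Rightarrow> complex) set" for N :: nat where
  const: "(\<lambda>p. c) \<in> mpoly N"
| var: "i < N \<Longrightarrow> (\<lambda>p. p i) \<in> mpoly N"
| add: "f \<in> mpoly N \<Longrightarrow> g \<in> mpoly N \<Longrightarrow> (\<lambda>p. f p + g p) \<in> mpoly N"
| mult: "f \<in> mpoly N \<Longrightarrow> g \<in> mpoly N \<Longrightarrow> (\<lambda>p. f p * g p) \<in> mpoly N"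

definition zero_set :: "nat \<Rightarrow> ((nat \<Rightarrow> complex) \<Rightarrow> complex) set \<Rightarrow> (nat \<Rightarrow> complex) set" where
  "zero_set N F = {p \<in> cspace N. \<forall>f\<in>F. f p = 0}"

definition zariski_closed :: "nat \<Rightarrow> (nat \<Rightarrow> complex) set \<Rightarrow> bool" where
  "zariski_closed N C \<longleftrightarrow> (\<exists>F \<subseteq> mpoly N. C = zero_set N F)"

definition zariski_closure :: "nat \<Rightarrow> (nat \<Rightarrow> complex) set \<Rightarrow> (nat \<Rightarrow> complex) set" where
  "zariski_closure N S = \<Inter> {C. zariski_closed N C \<and> S \<subseteq> C}"

definition zariski_irreducible :: "nat \<Rightarrow> (nat \<Rightarrow> complex) set \<Rightarrow> bool" where
  "zariski_irreducible N C \<longleftrightarrow> zariski_closed N C \<and> C \<noteq> {} \<and>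
     (\<forall>C1 C2. zariski_closed N C1 \<longrightarrow> zariski_closed N C2 \<longrightarrow> C \<subseteq> C1 \<union> C2 \<longrightarrow>
        C \<subseteq> C1 \<or> C \<subseteq> C2)"

definition irreducible_component :: "nat \<Rightarrow> (nat \<Rightarrow> complex) set \<Rightarrow> (nat \<Rightarrow> complex) set \<Rightarrow> bool" where
  "irreducible_component N A C \<longleftrightarrow> C \<subseteq> A \<and> zariski_irreducible N C \<and>
     (\<forall>C'. zariski_irreducible N C' \<longrightarrow> C \<subseteq> C' \<longrightarrow> C' \<subseteq> A \<longrightarrow> C' = C)"

text \<open>Holomorphic on an open set U of C^n: continuous and holomorphic in each variable
  separately (Osgood).\<close>

definition holo_on :: "nat \<Rightarrow> (nat \<Rightarrow> complex) set \<Rightarrow> ((nat \<Rightarrow> complex) \<Rightarrow> complex) \<Rightarrow> bool" where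
  "holo_on n U f \<longleftrightarrow> continuous_on U f \<and>
     (\<forall>t\<in>U. \<forall>k<n. (\<lambda>z. f (t(k := z))) field_differentiable (at (t k)))"

definition pdiff :: "nat \<Rightarrow> ((nat \<Rightarrow> complex) \<Rightarrow> complex) \<Rightarrow> (nat \<Rightarrow> complex) \<Rightarrow> complex" where
  "pdiff k f t = deriv (\<lambda>z. f (t(k := z))) (t k)"

text \<open>Coordinates in C^(n+m+r+1): T_k = k (k<n), Delta_(i+1) = n+i (i<m),
  X_(j+1) = n+m+j (j<r), Z = n+m+r. Data of a representation:
  e i, aN i, aD i for the i-th radical (i<m), aN i, aD i polynomials in T, Delta_1..Delta_i
  (i.e. variables < n+i); xN j, xD j polynomials in T, Delta (variables < n+m).
  The branches are functions delta i, analytic on U.\<close>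

definition td_point :: "nat \<Rightarrow> nat \<Rightarrow> (nat \<Rightarrow> (nat \<Rightarrow> complex) \<Rightarrow> complex) \<Rightarrow>
    (nat \<Rightarrow> complex) \<Rightarrow> (nat \<Rightarrow> complex)" where
  "td_point n m \<delta> t = (\<lambda>k. if k < n then t k else if k < n + m then \<delta> (k - n) t else 0)"

definition rp_x :: "nat \<Rightarrow> nat \<Rightarrow> (nat \<Rightarrow> (nat \<Rightarrow> complex) \<Rightarrow> complex) \<Rightarrow>
    (nat \<Rightarrow> (nat \<Rightarrow> complex) \<Rightarrow> complex) \<Rightarrow> (nat \<Rightarrow> (nat \<Rightarrow> complex) \<Rightarrow> complex) \<Rightarrow>
    nat \<Rightarrow> (nat \<Rightarrow> complex) \<Rightarrow> complex" where
  "rp_x n m \<delta> xN xD j t = xN j (td_point n m \<delta> t) / xD j (td_point n m \<delta> t)"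

definition rp_phi :: "nat \<Rightarrow> nat \<Rightarrow> nat \<Rightarrow> (nat \<Rightarrow> (nat \<Rightarrow> complex) \<Rightarrow> complex) \<Rightarrow>
    (nat \<Rightarrow> (nat \<Rightarrow> complex) \<Rightarrow> complex) \<Rightarrow> (nat \<Rightarrow> (nat \<Rightarrow> complex) \<Rightarrow> complex) \<Rightarrow>
    (nat \<Rightarrow> complex) \<Rightarrow> (nat \<Rightarrow> complex)" where
  "rp_phi n m r \<delta> xN xD t = (\<lambda>k. if k < n + m then td_point n m \<delta> t k
      else if k < n + m + r then rp_x n m \<delta> xN xD (k - (n + m)) t else 0)"

definition radical_parametrization ::
  "nat \<Rightarrow> nat \<Rightarrow> nat \<Rightarrow> (nat \<Rightarrow> nat) \<Rightarrow>
   (nat \<Rightarrow> (nat \<Rightarrow> complex) \<Rightarrow> complex) \<Rightarrow> (nat \<Rightarrow> (nat \<Rightarrow> complex) \<Rightarrow> complex) \<Rightarrow>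
   (nat \<Rightarrow> (nat \<Rightarrow> complex) \<Rightarrow> complex) \<Rightarrow> (nat \<Rightarrow> (nat \<Rightarrow> complex) \<Rightarrow> complex) \<Rightarrow>
   (nat \<Rightarrow> (nat \<Rightarrow> complex) \<Rightarrow> complex) \<Rightarrow> (nat \<Rightarrow> complex) set \<Rightarrow> bool" where
  "radical_parametrization n m r e aN aD xN xD \<delta> U \<longleftrightarrow>
     r > n \<and>
     (\<forall>i<m. e i > 0 \<and> aN i \<in> mpoly (n + i) \<and> aD i \<in> mpoly (n + i)) \<and>
     (\<forall>j<r. xN j \<in> mpoly (n + m) \<and> xD j \<in> mpoly (n + m)) \<and>
     U \<noteq> {} \<and> U \<subseteq> cspace n \<and> openin (top_of_set (cspace n)) U \<and> connected U \<and>
     (\<forall>i<m. holo_on n U (\<delta> i)) \<and>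
     (\<forall>t\<in>U. \<forall>i<m. aD i (td_point n m \<delta> t) \<noteq> 0 \<and>
         (\<delta> i t) ^ e i * aD i (td_point n m \<delta> t) = aN i (td_point n m \<delta> t)) \<and>
     (\<forall>t\<in>U. \<forall>j<r. xD j (td_point n m \<delta> t) \<noteq> 0) \<and>
     (\<exists>t\<in>U. \<forall>c :: nat \<Rightarrow> complex.
         (\<forall>j<r. (\<Sum>k<n. c k * pdiff k (rp_x n m \<delta> xN xD j) t) = 0) \<longrightarrow> (\<forall>k<n. c k = 0))"

definition incidence_variety ::
  "nat \<Rightarrow> nat \<Rightarrow> nat \<Rightarrow> (nat \<Rightarrow> (nat \<Rightarrow> complex) \<Rightarrow> complex) \<Rightarrow>
   (nat \<Rightarrow> (nat \<Rightarrow> complex) \<Rightarrow> complex) \<Rightarrow> (nat \<Rightarrow> (nat \<Rightarrow> complex) \<Rightarrow> complex) \<Rightarrow>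
   (nat \<Rightarrow> complex) set \<Rightarrow> (nat \<Rightarrow> complex) set" where
  "incidence_variety n m r \<delta> xN xD U = zariski_closure (n + m + r) (rp_phi n m r \<delta> xN xD ` U)"

definition E_poly :: "nat \<Rightarrow> (nat \<Rightarrow> nat) \<Rightarrow> (nat \<Rightarrow> (nat \<Rightarrow> complex) \<Rightarrow> complex) \<Rightarrow>
    (nat \<Rightarrow> (nat \<Rightarrow> complex) \<Rightarrow> complex) \<Rightarrow> nat \<Rightarrow> (nat \<Rightarrow> complex) \<Rightarrow> complex" where
  "E_poly n e aN aD i p = p (n + i) ^ e i * aD i p - aN i p"

definition G_poly :: "nat \<Rightarrow> nat \<Rightarrow> (nat \<Rightarrow> (nat \<Rightarrow> complex) \<Rightarrow> complex) \<Rightarrow>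
    (nat \<Rightarrow> (nat \<Rightarrow> complex) \<Rightarrow> complex) \<Rightarrow> nat \<Rightarrow> (nat \<Rightarrow> complex) \<Rightarrow> complex" where
  "G_poly n m xN xD j p = p (n + m + j) * xD j p - xN j p"

definition GZ_poly :: "nat \<Rightarrow> nat \<Rightarrow> nat \<Rightarrow> (nat \<Rightarrow> (nat \<Rightarrow> complex) \<Rightarrow> complex) \<Rightarrow>
    (nat \<Rightarrow> (nat \<Rightarrow> complex) \<Rightarrow> complex) \<Rightarrow> (nat \<Rightarrow> complex) \<Rightarrow> complex" where
  "GZ_poly n m r aD xD p =
     p (n + m + r) * ((\<Prod>j<r. xD j p) * (\<Prod>i<m. aD i p)) - 1"

definition auxiliary_variety ::
  "nat \<Rightarrow> nat \<Rightarrow> nat \<Rightarrow> (nat \<Rightarrow> nat) \<Rightarrow>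
   (nat \<Rightarrow> (nat \<Rightarrow> complex) \<Rightarrow> complex) \<Rightarrow> (nat \<Rightarrow> (nat \<Rightarrow> complex) \<Rightarrow> complex) \<Rightarrow>
   (nat \<Rightarrow> (nat \<Rightarrow> complex) \<Rightarrow> complex) \<Rightarrow> (nat \<Rightarrow> (nat \<Rightarrow> complex) \<Rightarrow> complex) \<Rightarrow>
   (nat \<Rightarrow> complex) set" where
  "auxiliary_variety n m r e aN aD xN xD =
     zariski_closure (n + m + r)
       ((\<lambda>p. p(n + m + r := 0)) `
          zero_set (n + m + r + 1)
            ({E_poly n e aN aD i | i. i < m} \<union> {G_poly n m xN xD j | j. j < r}
             \<union> {GZ_poly n m r aD xD}))"

end

theory Submission
  imports Defs "HOL-Complex_Analysis.Conformal_Mappings"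
begin

text \<open>The incidence variety is itself the component. It is irreducible because products of nonzero
  holomorphic functions on a connected open set are nonzero. Let \<open>C\<close> be an irreducible closed set
  between it and the auxiliary variety. On \<open>C\<close> the equations \<open>E\<^sub>i = 0\<close> and \<open>G\<^sub>j = 0\<close> make each
  coordinate algebraic over the preceding ones (the denominators do not vanish identically), so every
  polynomial \<open>f\<close> that is not identically zero on \<open>C\<close> divides, as a function on \<open>C\<close>, some nonzero
  \<open>q \<in> \<complex>[T]\<close>. If \<open>f\<close> vanished on the incidence variety, then so would \<open>q\<close>; but the \<open>T\<close>-coordinates
  there fill an open set, hence \<open>q = 0\<close>. So \<open>C\<close> equals the incidence variety, and no dimension
  theory is needed.\<close>

section \<open>Polynomial functions and the Zariski topology\<close>

lemma mpoly_mono: "f \<in> mpoly M \<Longrightarrow> M \<le> N \<Longrightarrow> f \<in> mpoly N"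
  by (induction rule: mpoly.induct) (auto intro: mpoly.intros)

text \<open>Lets the coordinates from \<open>N\<close> on be altered freely: \<open>Z\<close> can be
  added or dropped, and polynomials in T and Delta take the same value at \<open>rp_phi\<close> and
  at \<open>td_point\<close>.\<close>

lemma mpoly_cong: "f \<in> mpoly N \<Longrightarrow> (\<And>i. i < N \<Longrightarrow> p i = q i) \<Longrightarrow> f p = f q"
  by (induction rule: mpoly.induct) auto

lemma mpoly_uminus: "f \<in> mpoly N \<Longrightarrow> (\<lambda>p. - f p) \<in> mpoly N"
  using mpoly.mult[OF mpoly.const[of "-1" N]] by simp

lemma mpoly_diff: "f \<in> mpoly N \<Longrightarrow> g \<in> mpoly N \<Longrightarrow> (\<lambda>p. f p - g p) \<in> mpoly N"
  using mpoly.add[OF _ mpoly_uminus] by fastforce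

lemma mpoly_sum: "(\<And>i. i \<in> I \<Longrightarrow> f i \<in> mpoly N) \<Longrightarrow> (\<lambda>p. \<Sum>i\<in>I. f i p) \<in> mpoly N"
  by (induction I rule: infinite_finite_induct) (auto intro: mpoly.intros)

lemma mpoly_power: "f \<in> mpoly N \<Longrightarrow> (\<lambda>p. f p ^ k) \<in> mpoly N"
  by (induction k) (auto intro: mpoly.intros)

lemma zariski_closed_zero_set: "F \<subseteq> mpoly N \<Longrightarrow> zariski_closed N (zero_set N F)"
  by (auto simp: zariski_closed_def)

lemma zariski_closed_cspace: "zariski_closed N (cspace N)"
  unfolding zariski_closed_def by (rule exI[of _ "{}"]) (auto simp: zero_set_def)

lemma zariski_closed_Inter:
  assumes "\<And>C. C \<in> \<C> \<Longrightarrow> zariski_closed N C" "\<C> \<noteq> {}"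
  shows "zariski_closed N (\<Inter>\<C>)"
proof -
  obtain F where F: "\<And>C. C \<in> \<C> \<Longrightarrow> F C \<subseteq> mpoly N \<and> C = zero_set N (F C)"
    using assms(1) unfolding zariski_closed_def by metis
  have "\<Inter>\<C> = zero_set N (\<Union>C\<in>\<C>. F C)"
  proof
    show "\<Inter>\<C> \<subseteq> zero_set N (\<Union>C\<in>\<C>. F C)"
      using F assms(2) unfolding zero_set_def by blast
    show "zero_set N (\<Union>C\<in>\<C>. F C) \<subseteq> \<Inter>\<C>"
      using F unfolding zero_set_def by blast
  qed
  then show ?thesis using F unfolding zariski_closed_def by (intro exI[of _ "\<Union>C\<in>\<C>. F C"]) auto
qed

lemma zariski_closed_closure:
  assumes "S \<subseteq> cspace N"
  shows "zariski_closed N (zariski_closure N S)"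
  unfolding zariski_closure_def
  by (rule zariski_closed_Inter) (use zariski_closed_cspace assms in auto)

lemma zariski_closure_subset: "S \<subseteq> zariski_closure N S"
  by (auto simp: zariski_closure_def)

lemma zariski_closure_minimal: "zariski_closed N C \<Longrightarrow> S \<subseteq> C \<Longrightarrow> zariski_closure N S \<subseteq> C"
  by (auto simp: zariski_closure_def)

lemma zariski_closure_mono: "S \<subseteq> T \<Longrightarrow> zariski_closure N S \<subseteq> zariski_closure N T"
  by (auto simp: zariski_closure_def)

text \<open>The zero sets of \<open>f\<close> and \<open>g\<close> are closed and cover
  \<open>C\<close>, so one of them contains \<open>C\<close>. Hence the coordinate ring of
  \<open>C\<close> is a domain, the form in which irreducibility enters the algebra below.\<close>

lemma zariski_irreducible_domain:
  assumes "zariski_irreducible N C" "f \<in> mpoly N" "g \<in> mpoly N" "\<forall>p\<in>C. f p * g p = 0"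
  shows "(\<forall>p\<in>C. f p = 0) \<or> (\<forall>p\<in>C. g p = 0)"
proof -
  have "C \<subseteq> cspace N"
    using assms(1) by (auto simp: zariski_irreducible_def zariski_closed_def zero_set_def)
  then have "C \<subseteq> zero_set N {f} \<union> zero_set N {g}"
    using assms(4) by (auto simp: zero_set_def)
  moreover have "zariski_closed N (zero_set N {f})" "zariski_closed N (zero_set N {g})"
    using assms(2,3) by (auto intro: zariski_closed_zero_set)
  ultimately have "C \<subseteq> zero_set N {f} \<or> C \<subseteq> zero_set N {g}"
    using assms(1) unfolding zariski_irreducible_def by blast
  then show ?thesis by (auto simp: zero_set_def)
qed

section \<open>The identity theorem in several variables\<close>

text \<open>A product of discs: one coordinate can run through its whole disc without leaving the
  set.\<close>

definition polydisc :: "nat \<Rightarrow> (nat \<Rightarrow> complex) \<Rightarrow> real \<Rightarrow> (nat \<Rightarrow> complex) set" where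
  "polydisc n a \<epsilon> = {p \<in> cspace n. \<forall>k<n. cmod (p k - a k) < \<epsilon>}"

lemma polydisc_center: "a \<in> cspace n \<Longrightarrow> \<epsilon> > 0 \<Longrightarrow> a \<in> polydisc n a \<epsilon>"
  by (simp add: polydisc_def)

lemma openin_polydisc: "openin (top_of_set (cspace n)) (polydisc n a \<epsilon>)"
proof -
  have "open (\<Inter>k\<in>{..<n}. {p :: nat \<Rightarrow> complex. cmod (p k - a k) < \<epsilon>})"
    by (intro open_INT finite_lessThan ballI open_Collect_less continuous_intros
        continuous_on_product_coordinates)
  moreover have "polydisc n a \<epsilon> = cspace n \<inter> (\<Inter>k\<in>{..<n}. {p. cmod (p k - a k) < \<epsilon>})"
    by (auto simp: polydisc_def)
  ultimately show ?thesis by (auto simp: openin_open)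
qed

text \<open>The ambient topology is the product topology on \<open>nat => complex\<close>. All
  points of \<open>cspace n\<close> agree from index \<open>n\<close> on, so only the first
  \<open>n\<close> factors of a basic open box constrain them.\<close>

lemma polydisc_subset_openin:
  assumes "openin (top_of_set (cspace n)) S" "a \<in> S"
  obtains \<epsilon> where "\<epsilon> > 0" "polydisc n a \<epsilon> \<subseteq> S"
proof -
  obtain W where W: "open W" "S = cspace n \<inter> W"
    using assms(1) by (auto simp: openin_open)
  have "openin (product_topology (\<lambda>i. euclidean) UNIV) W"
    using W(1) by (simp add: open_fun_def)
  from product_topology_open_contains_basis[OF this, of a] obtain X
    where X: "a \<in> Pi\<^sub>E UNIV X" "\<And>i. open (X i)" "Pi\<^sub>E UNIV X \<subseteq> W"
    using assms(2) W(2) by auto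
  have "\<exists>d>0. ball (a i) d \<subseteq> X i" for i
    using X(1,2) by (meson PiE_mem UNIV_I open_contains_ball)
  then obtain d where d: "\<And>i. d i > 0" "\<And>i. ball (a i) (d i) \<subseteq> X i" by metis
  \<comment> \<open>The element 1 keeps the set under \<open>Min\<close> nonempty when
    \<open>n = 0\<close>.\<close>
  define \<epsilon> where "\<epsilon> = Min (insert 1 (d ` {..<n}))"
  have "\<epsilon> > 0" using d(1) by (auto simp: \<epsilon>_def)
  moreover have "polydisc n a \<epsilon> \<subseteq> S"
  proof
    fix p assume p: "p \<in> polydisc n a \<epsilon>"
    have "p i \<in> X i" for i
    proof (cases "i < n")
      case True
      then have "cmod (p i - a i) < \<epsilon>" "\<epsilon> \<le> d i" using p by (auto simp: polydisc_def \<epsilon>_def)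
      then show ?thesis using d(2)[of i] by (auto simp: dist_norm norm_minus_commute)
    next
      case False
      then have "p i = a i"
        using p assms(2) W(2) by (auto simp: polydisc_def cspace_def)
      then show ?thesis using X(1) by auto
    qed
    then show "p \<in> S" using X(3) p W(2) by (auto simp: polydisc_def)
  qed
  ultimately show ?thesis using that by blast
qed

lemma cspace_upd: "p \<in> cspace n \<Longrightarrow> k < n \<Longrightarrow> p(k := z) \<in> cspace n"
  by (auto simp: cspace_def)

text \<open>Vanishing spreads one coordinate at a time, so that only the one-variable identity theorem
  is needed.\<close>

lemma holo_on_zero_polydisc:
  assumes f: "holo_on n U f" and sub: "polydisc n a R \<subseteq> U"
    and x: "x \<in> polydisc n a R" and \<epsilon>: "\<epsilon> > 0"
    and zero: "\<And>p. p \<in> polydisc n a R \<Longrightarrow> p \<in> polydisc n x \<epsilon> \<Longrightarrow> f p = 0"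
    and y: "y \<in> polydisc n a R"
  shows "f y = 0"
proof -
  \<comment> \<open>Coordinates below \<open>k\<close> are free within the polydisc, the others stay
    within \<open>\<epsilon>\<close> of \<open>x\<close>; \<open>k = 0\<close> is the assumption
    \<open>zero\<close> and \<open>k = n\<close> is the goal.\<close>
  have "\<forall>p\<in>polydisc n a R. (\<forall>i<n. i \<ge> k \<longrightarrow> cmod (p i - x i) < \<epsilon>) \<longrightarrow> f p = 0" if "k \<le> n" for k
    using that
  proof (induction k)
    case 0
    then show ?case using zero by (auto simp: polydisc_def)
  next
    case (Suc k)
    show ?case
    proof (intro ballI impI)
      fix p assume p: "p \<in> polydisc n a R" and near: "\<forall>i<n. i \<ge> Suc k \<longrightarrow> cmod (p i - x i) < \<epsilon>"
      have k: "k < n" using Suc by simp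
      have mem: "p(k := z) \<in> polydisc n a R" if "z \<in> ball (a k) R" for z
        using p k that by (auto simp: polydisc_def cspace_upd dist_norm norm_minus_commute)
      have "(\<lambda>z. f (p(k := z))) field_differentiable at z" if "z \<in> ball (a k) R" for z
      proof -
        have "(\<lambda>w. f ((p(k := z))(k := w))) field_differentiable at ((p(k := z)) k)"
          using f mem[OF that] sub k unfolding holo_on_def by blast
        then show ?thesis by simp
      qed
      then have hol: "(\<lambda>z. f (p(k := z))) holomorphic_on ball (a k) R"
        by (simp add: holomorphic_on_def field_differentiable_at_within)
      \<comment> \<open>The induction hypothesis covers values of coordinate \<open>k\<close> close
        to \<open>x k\<close>; the slice is holomorphic on the whole disc about \<open>a k\<close>,
        so it vanishes on all of it.\<close>
      have "(\<lambda>z. f (p(k := z))) (p k) = (\<lambda>z. 0) (p k)"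
      proof (rule analytic_continuation_open[where f = "\<lambda>z. f (p(k := z))" and g = "\<lambda>z. 0"
            and s = "ball (a k) R \<inter> ball (x k) \<epsilon>" and s' = "ball (a k) R"])
        show "ball (a k) R \<inter> ball (x k) \<epsilon> \<noteq> {}"
        proof -
          have "x k \<in> ball (a k) R \<inter> ball (x k) \<epsilon>"
            using x k \<epsilon> by (auto simp: polydisc_def dist_norm norm_minus_commute)
          then show ?thesis by blast
        qed
        show "p k \<in> ball (a k) R"
          using p k by (auto simp: polydisc_def dist_norm norm_minus_commute)
        show "f (p(k := z)) = 0" if "z \<in> ball (a k) R \<inter> ball (x k) \<epsilon>" for z
        proof -
          have "\<forall>i<n. i \<ge> k \<longrightarrow> cmod ((p(k := z)) i - x i) < \<epsilon>"
            using near that by (auto simp: dist_norm norm_minus_commute)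
          then show ?thesis using Suc mem that by auto
        qed
      qed (use hol in auto)
      then show "f p = 0" by simp
    qed
  qed
  from this[of n] y show ?thesis by auto
qed

text \<open>Vanishing near a point is a locally constant property, since zeros spread over
  polydiscs; on the connected set \<open>U\<close> it is therefore constant.\<close>

theorem holo_on_identity:
  assumes U: "openin (top_of_set (cspace n)) U" "connected U" and f: "holo_on n U f"
    and D: "openin (top_of_set (cspace n)) D" "D \<subseteq> U" "D \<noteq> {}" "\<And>p. p \<in> D \<Longrightarrow> f p = 0"
    and b: "b \<in> U"
  shows "f b = 0"
proof -
  define Q where "Q x \<longleftrightarrow> (\<exists>\<epsilon>>0. \<forall>p\<in>polydisc n x \<epsilon>. p \<in> U \<longrightarrow> f p = 0)" for x
  have Uc: "U \<subseteq> cspace n" using U(1) by (auto dest: openin_imp_subset)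
  obtain a where a: "a \<in> D" using D(3) by auto
  obtain \<epsilon> where "\<epsilon> > 0" "polydisc n a \<epsilon> \<subseteq> D" using polydisc_subset_openin[OF D(1) a] by auto
  then have "Q a" using D(4) unfolding Q_def by blast
  have "Q b"
  proof (rule connected_induction_simple[OF U(2), where P = Q and a = a])
    show "a \<in> U" using a D(2) by auto
    fix c assume c: "c \<in> U"
    obtain R where R: "R > 0" "polydisc n c R \<subseteq> U" using polydisc_subset_openin[OF U(1) c] by auto
    show "\<exists>T. openin (top_of_set U) T \<and> c \<in> T \<and> (\<forall>x\<in>T. \<forall>y\<in>T. Q x \<longrightarrow> Q y)"
    proof (intro exI conjI ballI impI)
      show "openin (top_of_set U) (polydisc n c R)"
        using openin_polydisc R(2) Uc by (rule openin_subset_trans)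
      show "c \<in> polydisc n c R" using c Uc R by (auto intro: polydisc_center)
      fix x y assume xy: "x \<in> polydisc n c R" "y \<in> polydisc n c R" and "Q x"
      then obtain \<epsilon> where \<epsilon>: "\<epsilon> > 0" "\<And>p. p \<in> polydisc n x \<epsilon> \<Longrightarrow> p \<in> U \<Longrightarrow> f p = 0"
        unfolding Q_def by auto
      have zero: "f p = 0" if "p \<in> polydisc n c R" for p
        by (rule holo_on_zero_polydisc[OF f R(2) xy(1) \<epsilon>(1) _ that]) (use \<epsilon>(2) R(2) in auto)
      obtain \<epsilon>' where "\<epsilon>' > 0" "polydisc n y \<epsilon>' \<subseteq> polydisc n c R"
        using polydisc_subset_openin[OF openin_polydisc xy(2)] by auto
      then show "Q y" using zero unfolding Q_def by blast
    qed
  qed (use \<open>Q a\<close> b in auto)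
  then show ?thesis using b Uc polydisc_center unfolding Q_def by blast
qed

text \<open>The set where \<open>g\<close> is nonzero is open and \<open>f\<close> vanishes on it;
  if it is nonempty, the identity theorem applies to \<open>f\<close>.\<close>

lemma holo_on_domain:
  assumes U: "openin (top_of_set (cspace n)) U" "connected U"
    and f: "holo_on n U f" and g: "holo_on n U g" and fg: "\<And>t. t \<in> U \<Longrightarrow> f t * g t = 0"
  shows "(\<forall>t\<in>U. f t = 0) \<or> (\<forall>t\<in>U. g t = 0)"
proof (rule disjCI)
  assume "\<not> (\<forall>t\<in>U. g t = 0)"
  define D where "D = U \<inter> g -` (- {0})"
  have "openin (top_of_set U) D"
    using g unfolding D_def holo_on_def by (intro continuous_openin_preimage_gen) auto
  then have "openin (top_of_set (cspace n)) D"
    using U(1) by (rule openin_trans)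
  moreover have "D \<noteq> {}" "D \<subseteq> U" using \<open>\<not> (\<forall>t\<in>U. g t = 0)\<close> by (auto simp: D_def)
  moreover have "\<And>p. p \<in> D \<Longrightarrow> f p = 0" using fg by (fastforce simp: D_def)
  ultimately show "\<forall>t\<in>U. f t = 0" using holo_on_identity[OF U f] by blast
qed

section \<open>Closure properties of holomorphic functions\<close>

lemma holo_on_const: "holo_on n U (\<lambda>t. c)"
  by (auto simp: holo_on_def)

lemma holo_on_coord: "holo_on n U (\<lambda>t. t i)"
proof -
  have "(\<lambda>z. (t(k := z)) i) field_differentiable at w" for t :: "nat \<Rightarrow> complex" and k w
    by (cases "i = k") auto
  then show ?thesis
    by (auto simp: holo_on_def intro: continuous_on_subset[OF continuous_on_product_coordinates])
qed

lemma holo_on_add: "holo_on n U f \<Longrightarrow> holo_on n U g \<Longrightarrow> holo_on n U (\<lambda>t. f t + g t)"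
  by (auto simp: holo_on_def intro!: continuous_intros derivative_intros field_differentiable_add)

lemma holo_on_mult: "holo_on n U f \<Longrightarrow> holo_on n U g \<Longrightarrow> holo_on n U (\<lambda>t. f t * g t)"
  by (auto simp: holo_on_def intro!: continuous_intros field_differentiable_mult)

lemma holo_on_divide:
  "holo_on n U f \<Longrightarrow> holo_on n U g \<Longrightarrow> (\<And>t. t \<in> U \<Longrightarrow> g t \<noteq> 0) \<Longrightarrow> holo_on n U (\<lambda>t. f t / g t)"
  by (auto simp: holo_on_def intro!: continuous_intros field_differentiable_divide)

lemma holo_on_mpoly:
  "f \<in> mpoly N \<Longrightarrow> (\<And>i. i < N \<Longrightarrow> holo_on n U (\<lambda>t. P t i)) \<Longrightarrow> holo_on n U (\<lambda>t. f (P t))"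
  by (induction rule: mpoly.induct) (auto intro: holo_on_const holo_on_add holo_on_mult)

text \<open>A polynomial is holomorphic on all of C^n, so its zeros near a point of \<open>U\<close>
  spread over a polydisc large enough to reach any given point.\<close>

lemma mpoly_eq_zero_if_zero_on_open:
  assumes f: "f \<in> mpoly n" and U: "openin (top_of_set (cspace n)) U" "U \<noteq> {}"
    and zero: "\<And>t. t \<in> U \<Longrightarrow> f t = 0"
  shows "f p = 0"
proof -
  \<comment> \<open>\<open>p\<close> may have nonzero entries from index \<open>n\<close> on, which
    \<open>f\<close> does not see; truncation moves it into \<open>cspace n\<close>.\<close>
  define p' where "p' = (\<lambda>k. if k < n then p k else 0)"
  obtain a where a: "a \<in> U" using U(2) by auto
  obtain \<epsilon> where \<epsilon>: "\<epsilon> > 0" "polydisc n a \<epsilon> \<subseteq> U" using polydisc_subset_openin[OF U(1) a] .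
  \<comment> \<open>The sum bounds every coordinate distance; the summand 1 makes the bound strict
    and \<open>R\<close> positive.\<close>
  define R where "R = 1 + (\<Sum>k<n. cmod (p' k - a k))"
  have "cmod (p' k - a k) < R" if "k < n" for k
    using member_le_sum[of k "{..<n}" "\<lambda>k. cmod (p' k - a k)"] that by (simp add: R_def)
  then have p': "p' \<in> polydisc n a R" by (simp add: polydisc_def p'_def cspace_def)
  have "R > 0" unfolding R_def by (intro add_pos_nonneg sum_nonneg) auto
  then have "a \<in> polydisc n a R"
    using a openin_imp_subset[OF U(1)] by (intro polydisc_center) auto
  moreover have "polydisc n a R \<subseteq> cspace n" by (auto simp: polydisc_def)
  moreover have "holo_on n (cspace n) f"
    using holo_on_mpoly[OF f, of n _ "\<lambda>t. t"] holo_on_coord by auto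
  ultimately have "f p' = 0"
    using holo_on_zero_polydisc[of n "cspace n" f a R a \<epsilon> p'] p' \<epsilon> zero by blast
  moreover have "f p = f p'" using f by (rule mpoly_cong) (simp add: p'_def)
  ultimately show ?thesis by simp
qed

text \<open>If the image lay in neither closed set, one equation of each would pull back to a
  holomorphic function on \<open>U\<close> that is not identically zero, while the product of the
  two is zero.\<close>

theorem zariski_irreducible_closure_holo_image:
  assumes U: "openin (top_of_set (cspace n)) U" "connected U" "U \<noteq> {}"
    and P: "P ` U \<subseteq> cspace N" "\<And>i. i < N \<Longrightarrow> holo_on n U (\<lambda>t. P t i)"
  shows "zariski_irreducible N (zariski_closure N (P ` U))"
  unfolding zariski_irreducible_def
proof (intro conjI allI impI)
  show "zariski_closed N (zariski_closure N (P ` U))" using P(1) by (rule zariski_closed_closure)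
  show "zariski_closure N (P ` U) \<noteq> {}" using zariski_closure_subset[of "P ` U"] U(3) by blast
  fix C1 C2
  assume C: "zariski_closed N C1" "zariski_closed N C2" "zariski_closure N (P ` U) \<subseteq> C1 \<union> C2"
  obtain F1 F2 where F: "F1 \<subseteq> mpoly N" "C1 = zero_set N F1" "F2 \<subseteq> mpoly N" "C2 = zero_set N F2"
    using C(1,2) unfolding zariski_closed_def by auto
  have "P ` U \<subseteq> C1 \<or> P ` U \<subseteq> C2"
  proof (rule ccontr)
    assume "\<not> (P ` U \<subseteq> C1 \<or> P ` U \<subseteq> C2)"
    then obtain f1 f2 t1 t2 where f: "f1 \<in> F1" "f2 \<in> F2" "t1 \<in> U" "t2 \<in> U" "f1 (P t1) \<noteq> 0" "f2 (P t2) \<noteq> 0"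
      using F P(1) unfolding zero_set_def by blast
    have "P ` U \<subseteq> C1 \<union> C2" using C(3) zariski_closure_subset by blast
    then have "f1 (P t) * f2 (P t) = 0" if "t \<in> U" for t
      using that f F unfolding zero_set_def by auto
    moreover have "holo_on n U (\<lambda>t. h (P t))" if "h \<in> mpoly N" for h
      using that P(2) by (rule holo_on_mpoly)
    then have "holo_on n U (\<lambda>t. f1 (P t))" "holo_on n U (\<lambda>t. f2 (P t))"
      using f F by blast+
    ultimately show False using holo_on_domain[OF U(1,2)] f(3-6) by blast
  qed
  then show "zariski_closure N (P ` U) \<subseteq> C1 \<or> zariski_closure N (P ` U) \<subseteq> C2"
    using C zariski_closure_minimal by metis
qed

section \<open>Fractional spans over the base polynomial ring\<close>

text \<open>Polynomial functions compared only on \<open>C\<close> stand for the coordinate ring of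
  \<open>C\<close>, an integral domain by \<open>domain\<close>; those in \<open>mpoly n\<close>
  form the base ring.\<close>

locale polynomial_domain =
  fixes n N :: nat and C :: "(nat \<Rightarrow> complex) set"
  assumes n_le_N: "n \<le> N" and nonempty: "C \<noteq> {}"
    and domain: "\<And>f g. f \<in> mpoly N \<Longrightarrow> g \<in> mpoly N \<Longrightarrow> \<forall>p\<in>C. f p * g p = 0 \<Longrightarrow>
      (\<forall>p\<in>C. f p = 0) \<or> (\<forall>p\<in>C. g p = 0)"
begin

text \<open>These are the admissible denominators: base polynomials that are nonzero in the
  coordinate ring.\<close>

definition base_nonzero :: "((nat \<Rightarrow> complex) \<Rightarrow> complex) \<Rightarrow> bool" where
  "base_nonzero q \<longleftrightarrow> q \<in> mpoly n \<and> (\<exists>p\<in>C. q p \<noteq> 0)"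

lemma base_nonzero_mult:
  assumes "base_nonzero q" "base_nonzero q'"
  shows "base_nonzero (\<lambda>p. q p * q' p)"
  using assms domain[of q q'] mpoly_mono[OF _ n_le_N] unfolding base_nonzero_def
  by (auto intro: mpoly.mult)

lemma base_nonzero_one: "base_nonzero (\<lambda>p. 1)"
  using nonempty by (auto simp: base_nonzero_def mpoly.const)

text \<open>The linear span of \<open>B\<close> over the fraction field of the base ring, with
  denominators cleared so that no quotient field is constructed. Only values on \<open>C\<close>
  matter.\<close>

definition frac_span ::
    "((nat \<Rightarrow> complex) \<Rightarrow> complex) set \<Rightarrow> ((nat \<Rightarrow> complex) \<Rightarrow> complex) set" where
  "frac_span B = {f. \<exists>q c. base_nonzero q \<and> (\<forall>b\<in>B. c b \<in> mpoly n) \<and>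
     (\<forall>p\<in>C. q p * f p = (\<Sum>b\<in>B. c b p * b p))}"

lemma frac_span_base:
  assumes "finite B" "b \<in> B"
  shows "b \<in> frac_span B"
proof -
  have "(\<Sum>b'\<in>B. (if b' = b then 1 else 0) * b' p) = b p" for p
    using assms by (simp add: if_distrib[of "\<lambda>x. x * _"] cong: if_cong)
  then show ?thesis
    unfolding frac_span_def
    by (auto intro!: exI[of _ "\<lambda>p. 1"] exI[of _ "\<lambda>b' p. if b' = b then 1 else 0"] base_nonzero_one
        simp: mpoly.const)
qed

lemma frac_span_zero: "(\<lambda>p. 0) \<in> frac_span B"
  unfolding frac_span_def
  by (auto intro!: exI[of _ "\<lambda>p. 1"] exI[of _ "\<lambda>b p. 0"] base_nonzero_one simp: mpoly.const)

lemma frac_span_scale: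
  assumes "c \<in> mpoly n" "f \<in> frac_span B"
  shows "(\<lambda>p. c p * f p) \<in> frac_span B"
proof -
  obtain q d where f: "base_nonzero q" "\<forall>b\<in>B. d b \<in> mpoly n"
    "\<forall>p\<in>C. q p * f p = (\<Sum>b\<in>B. d b p * b p)"
    using assms(2) unfolding frac_span_def by blast
  define d' where "d' b p = c p * d b p" for b p
  have "q p * (c p * f p) = (\<Sum>b\<in>B. d' b p * b p)" if "p \<in> C" for p
  proof -
    have "q p * (c p * f p) = c p * (q p * f p)" by (rule mult.left_commute)
    then show ?thesis using f(3) that by (simp add: d'_def sum_distrib_left mult.assoc)
  qed
  moreover have "\<forall>b\<in>B. d' b \<in> mpoly n"
    using f(2) assms(1) unfolding d'_def by (auto intro!: mpoly.mult)
  ultimately show ?thesis using f(1) unfolding frac_span_def by blast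
qed

lemma frac_span_add:
  assumes "f \<in> frac_span B" "g \<in> frac_span B"
  shows "(\<lambda>p. f p + g p) \<in> frac_span B"
proof -
  obtain q c where f: "base_nonzero q" "\<forall>b\<in>B. c b \<in> mpoly n"
    "\<forall>p\<in>C. q p * f p = (\<Sum>b\<in>B. c b p * b p)"
    using assms(1) unfolding frac_span_def by blast
  obtain q' c' where g: "base_nonzero q'" "\<forall>b\<in>B. c' b \<in> mpoly n"
    "\<forall>p\<in>C. q' p * g p = (\<Sum>b\<in>B. c' b p * b p)"
    using assms(2) unfolding frac_span_def by blast
  define d where "d b p = q' p * c b p + q p * c' b p" for b p
  have "(q p * q' p) * (f p + g p) = (\<Sum>b\<in>B. d b p * b p)" if "p \<in> C" for p
  proof -
    have "(q p * q' p) * (f p + g p) = q' p * (q p * f p) + q p * (q' p * g p)"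
      by (simp add: algebra_simps)
    also have "\<dots> = (\<Sum>b\<in>B. d b p * b p)"
      using f(3) g(3) that
      by (simp add: d_def distrib_right sum.distrib sum_distrib_left mult.assoc)
    finally show ?thesis .
  qed
  moreover have "\<forall>b\<in>B. d b \<in> mpoly n"
    using f(1,2) g(1,2) unfolding d_def base_nonzero_def by (auto intro!: mpoly.add mpoly.mult)
  ultimately show ?thesis
    using base_nonzero_mult[OF f(1) g(1)] unfolding frac_span_def by blast
qed

lemma frac_span_sum:
  "(\<And>i. i \<in> I \<Longrightarrow> f i \<in> frac_span B) \<Longrightarrow> (\<lambda>p. \<Sum>i\<in>I. f i p) \<in> frac_span B"
  by (induction I rule: infinite_finite_induct) (auto intro: frac_span_zero frac_span_add)

lemma frac_span_divide:
  assumes "base_nonzero q" "g \<in> frac_span B" "\<forall>p\<in>C. q p * f p = g p"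
  shows "f \<in> frac_span B"
proof -
  obtain q' c where g: "base_nonzero q'" "\<forall>b\<in>B. c b \<in> mpoly n"
    "\<forall>p\<in>C. q' p * g p = (\<Sum>b\<in>B. c b p * b p)"
    using assms(2) unfolding frac_span_def by blast
  then have "\<forall>p\<in>C. (q' p * q p) * f p = (\<Sum>b\<in>B. c b p * b p)"
    using assms(3) by (simp add: mult.assoc)
  then show ?thesis
    using base_nonzero_mult[OF g(1) assms(1)] g(2) unfolding frac_span_def by blast
qed

text \<open>Multiplication by \<open>g\<close> is linear over the fraction field, so checking it on
  generators is enough.\<close>

lemma frac_span_image:
  assumes "\<And>b. b \<in> B \<Longrightarrow> (\<lambda>p. g p * b p) \<in> frac_span B'" "f \<in> frac_span B"
  shows "(\<lambda>p. g p * f p) \<in> frac_span B'"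
proof -
  obtain q c where f: "base_nonzero q" "\<forall>b\<in>B. c b \<in> mpoly n"
    "\<forall>p\<in>C. q p * f p = (\<Sum>b\<in>B. c b p * b p)"
    using assms(2) unfolding frac_span_def by blast
  show ?thesis
  proof (rule frac_span_divide[OF f(1)])
    show "(\<lambda>p. \<Sum>b\<in>B. c b p * (g p * b p)) \<in> frac_span B'"
      using f(2) assms(1) by (intro frac_span_sum frac_span_scale[of "c _"]) auto
    have "q p * (g p * f p) = g p * (q p * f p)" for p by (simp add: mult.left_commute)
    then show "\<forall>p\<in>C. q p * (g p * f p) = (\<Sum>b\<in>B. c b p * (g p * b p))"
      using f(3) by (simp add: sum_distrib_left mult.left_commute)
  qed
qed

lemma frac_span_insertE:
  assumes "finite B" "b \<notin> B" "f \<in> frac_span (insert b B)"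
  obtains q a w where "base_nonzero q" "a \<in> mpoly n" "w \<in> frac_span B"
    "\<forall>p\<in>C. q p * f p = a p * b p + w p"
proof -
  obtain q c where f: "base_nonzero q" "\<forall>b'\<in>insert b B. c b' \<in> mpoly n"
    "\<forall>p\<in>C. q p * f p = (\<Sum>b'\<in>insert b B. c b' p * b' p)"
    using assms(3) unfolding frac_span_def by blast
  have "(\<lambda>p. \<Sum>b'\<in>B. c b' p * b' p) \<in> frac_span B"
    using f(2) assms(1) by (intro frac_span_sum frac_span_scale frac_span_base) auto
  then show ?thesis using that[of q "c b"] f assms(1,2) by simp
qed

text \<open>Gaussian elimination without division: cross-multiplication removes one generator and
  one vector at a time, which keeps the coefficients in the base ring.\<close>

theorem frac_span_dependent:
  assumes "finite B" "finite I" "card B < card I" "\<And>i. i \<in> I \<Longrightarrow> v i \<in> frac_span B"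
  shows "\<exists>c. (\<forall>i\<in>I. c i \<in> mpoly n) \<and> (\<exists>i\<in>I. base_nonzero (c i)) \<and>
    (\<forall>p\<in>C. (\<Sum>i\<in>I. c i p * v i p) = 0)"
  using assms
proof (induction B arbitrary: I v rule: finite_induct)
  case empty
  then obtain j where j: "j \<in> I" by fastforce
  then obtain q where q: "base_nonzero q" "\<forall>p\<in>C. q p * v j p = 0"
    using empty(3)[OF j] unfolding frac_span_def by auto
  have eq: "(\<Sum>i\<in>I. (if i = j then q p else 0) * v i p) = q p * v j p" for p
    using j empty(1) by (simp add: if_distrib[of "\<lambda>x. x * _"] cong: if_cong)
  have "(\<lambda>p. if i = j then q p else 0) \<in> mpoly n" for i
    using q(1) by (cases "i = j") (auto simp: base_nonzero_def mpoly.const)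
  moreover have "base_nonzero (\<lambda>p. if j = j then q p else 0)" using q(1) by simp
  ultimately show ?case
    using eq q(2) j
    by (intro exI[of _ "\<lambda>i p. if i = j then q p else 0"] conjI bexI[of _ j]) auto
next
  case (insert b B)
  have "\<exists>q a w. base_nonzero q \<and> a \<in> mpoly n \<and> w \<in> frac_span B \<and>
      (\<forall>p\<in>C. q p * v i p = a p * b p + w p)" if "i \<in> I" for i
    using frac_span_insertE[OF insert(1,2) insert(6)[OF that]] by metis
  then obtain q a w where v: "\<And>i. i \<in> I \<Longrightarrow> base_nonzero (q i)"
    "\<And>i. i \<in> I \<Longrightarrow> a i \<in> mpoly n" "\<And>i. i \<in> I \<Longrightarrow> w i \<in> frac_span B"
    "\<And>i p. i \<in> I \<Longrightarrow> p \<in> C \<Longrightarrow> q i p * v i p = a i p * b p + w i p"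
    by metis
  show ?case
  proof (cases "\<exists>j\<in>I. base_nonzero (a j)")
    case False
    then have "v i \<in> frac_span B" if "i \<in> I" for i
      using v[OF that] that by (intro frac_span_divide[of "q i" "w i" _ "v i"]) (auto simp: base_nonzero_def)
    then show ?thesis using insert by simp
  next
    case True
    then obtain j where j: "j \<in> I" "base_nonzero (a j)" by auto
    define I' where "I' = I - {j}"
    have I: "I = insert j I'" "j \<notin> I'" "finite I'" using j(1) insert(4) by (auto simp: I'_def)
    \<comment> \<open>On \<open>C\<close>, \<open>u i\<close> equals
      \<open>a j * q i * v i - a i * q j * v j\<close>: the terms in \<open>b\<close> cancel, which
      puts \<open>u i\<close> in the span of \<open>B\<close>.\<close>
    define u where "u i p = a j p * w i p + - a i p * w j p" for i p
    have "u i \<in> frac_span B" if "i \<in> I'" for i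
      unfolding u_def using v that j(1) I
      by (intro frac_span_add frac_span_scale mpoly_uminus) auto
    moreover have "card B < card I'" using insert I by simp
    ultimately obtain c k where c: "\<And>i. i \<in> I' \<Longrightarrow> c i \<in> mpoly n"
      "k \<in> I'" "base_nonzero (c k)" "\<And>p. p \<in> C \<Longrightarrow> (\<Sum>i\<in>I'. c i p * u i p) = 0"
      using insert(3)[OF I(3)] by metis
    \<comment> \<open>Obtained by rewriting the relation among the \<open>u i\<close> in terms of
      the \<open>v i\<close>, with all multiples of \<open>v j\<close> collected. It is nontrivial
      at \<open>k\<close>, since \<open>c k\<close>, \<open>a j\<close> and \<open>q k\<close> are
      nonzero in a domain.\<close>
    define d where "d i = (if i = j then (\<lambda>p. - (\<Sum>i\<in>I'. c i p * a i p * q j p))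
        else (\<lambda>p. c i p * (a j p * q i p)))" for i
    have mp: "q i \<in> mpoly n" "a i \<in> mpoly n" if "i \<in> I" for i
      using v(1,2)[OF that] by (auto simp: base_nonzero_def)
    have "d i \<in> mpoly n" if "i \<in> I" for i
      unfolding d_def using mp j(1) c(1) that I
      by (auto intro!: mpoly_uminus mpoly_sum mpoly.mult)
    moreover have "base_nonzero (d k)"
      using c(2,3) I j(2) v(1)[of k] by (auto simp: d_def intro!: base_nonzero_mult)
    moreover have "(\<Sum>i\<in>I. d i p * v i p) = 0" if p: "p \<in> C" for p
    proof -
      have "(\<Sum>i\<in>I. d i p * v i p) =
          (\<Sum>i\<in>I'. d i p * v i p) - (\<Sum>i\<in>I'. c i p * a i p * q j p) * v j p"
        using I by (simp add: d_def)
      also have "(\<Sum>i\<in>I'. d i p * v i p) = (\<Sum>i\<in>I'. c i p * a j p * (q i p * v i p))"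
        using I(2) by (intro sum.cong) (auto simp: d_def algebra_simps)
      also have "\<dots> - (\<Sum>i\<in>I'. c i p * a i p * q j p) * v j p =
          (\<Sum>i\<in>I'. c i p * (a j p * (q i p * v i p) - a i p * (q j p * v j p)))"
        by (simp add: sum_distrib_right right_diff_distrib sum_subtractf mult.assoc)
      also have "\<dots> = (\<Sum>i\<in>I'. c i p * u i p)"
      proof (rule sum.cong[OF refl])
        fix i assume "i \<in> I'"
        then have "q i p * v i p = a i p * b p + w i p" "q j p * v j p = a j p * b p + w j p"
          using v(4)[OF _ p] j(1) I by auto
        then show "c i p * (a j p * (q i p * v i p) - a i p * (q j p * v j p)) = c i p * u i p"
          by (simp add: u_def algebra_simps)
      qed
      finally show ?thesis using c(4)[OF p] by simp
    qed
    ultimately show ?thesis using c(2) I(1) by blast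
  qed
qed

text \<open>The span contains 1 and is stable under multiplication by polynomials in the first
  \<open>L\<close> coordinates, so it contains them all. This expresses that those coordinates are
  algebraic over the base ring on \<open>C\<close>.\<close>

definition finite_rank :: "nat \<Rightarrow> bool" where
  "finite_rank L \<longleftrightarrow> (\<exists>B. finite B \<and> (\<lambda>p. 1) \<in> frac_span B \<and>
     (\<forall>f\<in>mpoly L. \<forall>h\<in>frac_span B. (\<lambda>p. f p * h p) \<in> frac_span B))"

text \<open>The multipliers that preserve the span are closed under sums and products and include
  the constants, so only the variables have to be tested.\<close>

lemma finite_rankI:
  assumes "finite B" "(\<lambda>p. 1) \<in> frac_span B"
    and var: "\<And>i b. i < L \<Longrightarrow> b \<in> B \<Longrightarrow> (\<lambda>p. p i * b p) \<in> frac_span B"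
  shows "finite_rank L"
proof -
  have "\<forall>h\<in>frac_span B. (\<lambda>p. f p * h p) \<in> frac_span B" if "f \<in> mpoly L" for f
    using that
  proof induction
    case (const c)
    then show ?case by (auto intro: frac_span_scale mpoly.const)
  next
    case (var i)
    then show ?case using assms(3) frac_span_image[of B "\<lambda>p. p i"] by blast
  next
    case (add f g)
    then show ?case by (auto simp: distrib_right intro: frac_span_add)
  next
    case (mult f g)
    then show ?case by (auto simp: mult.assoc)
  qed
  then show ?thesis using assms(1,2) unfolding finite_rank_def by blast
qed

lemma finite_rank_base: "finite_rank n"
proof (rule finite_rankI)
  show "(\<lambda>p. 1) \<in> frac_span {\<lambda>p. 1}" by (rule frac_span_base) auto
  show "(\<lambda>p. p i * b p) \<in> frac_span {\<lambda>p. 1}" if "i < n" "b \<in> {\<lambda>p. 1}" for i b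
    using that frac_span_scale[OF mpoly.var frac_span_base[of "{\<lambda>p. 1}" "\<lambda>p. 1"]] by simp
qed simp

text \<open>The powers of \<open>f\<close> are dependent over the base ring; after cancelling a power of \<open>f\<close> from
  the relation, its constant term is nonzero and divisible by \<open>f\<close>.\<close>

lemma finite_rank_multiple_in_base:
  assumes L: "finite_rank L" "L \<le> N" and f: "f \<in> mpoly L" "\<exists>p\<in>C. f p \<noteq> 0" and nL: "n \<le> L"
  obtains q g where "base_nonzero q" "g \<in> mpoly L" "\<forall>p\<in>C. q p = f p * g p"
proof -
  obtain B where B: "finite B" "(\<lambda>p. 1) \<in> frac_span B"
    "\<And>f h. f \<in> mpoly L \<Longrightarrow> h \<in> frac_span B \<Longrightarrow> (\<lambda>p. f p * h p) \<in> frac_span B"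
    using L(1) unfolding finite_rank_def by blast
  have "(\<lambda>p. f p ^ k) \<in> frac_span B" for k
    using B(3)[OF mpoly_power[OF f(1)] B(2)] by simp
  \<comment> \<open>The exponents from 0 to \<open>card B\<close> give one more vector than there
    are generators.\<close>
  then obtain c where c: "\<And>i. i \<le> card B \<Longrightarrow> c i \<in> mpoly n" "\<exists>i\<le>card B. base_nonzero (c i)"
    "\<And>p. p \<in> C \<Longrightarrow> (\<Sum>i\<le>card B. c i p * f p ^ i) = 0"
    using frac_span_dependent[of B "{..card B}" "\<lambda>k p. f p ^ k"] B(1) by auto
  define m where "m = (LEAST i. i \<le> card B \<and> base_nonzero (c i))"
  have m: "m \<le> card B" "base_nonzero (c m)"
    using LeastI_ex[OF c(2)[unfolded bex_simps]] unfolding m_def by auto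
  \<comment> \<open>A base polynomial that is not \<open>base_nonzero\<close> vanishes on all of
    \<open>C\<close>, so minimality of \<open>m\<close> removes the lower terms entirely.\<close>
  have below: "c i p = 0" if "i < m" "p \<in> C" for i p
    using not_less_Least[of i "\<lambda>i. i \<le> card B \<and> base_nonzero (c i)"] that m(1) c(1)[of i]
    unfolding m_def base_nonzero_def by auto
  \<comment> \<open>Dividing the relation by \<open>f ^ m\<close> and solving for the constant term
    gives \<open>c m = f * g\<close>. As \<open>i > m\<close>, the subtraction
    \<open>i - Suc m\<close> is not truncated.\<close>
  define g where "g p = - (\<Sum>i\<in>{m<..card B}. c i p * f p ^ (i - Suc m))" for p
  have cL: "c i \<in> mpoly L" if "i \<le> card B" for i using c(1)[OF that] mpoly_mono nL by blast
  have g: "g \<in> mpoly L"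
    unfolding g_def using cL f(1) by (auto intro!: mpoly_uminus mpoly_sum mpoly.mult mpoly_power)
  \<comment> \<open>The relation itself only yields \<open>f ^ m * h = 0\<close> on
    \<open>C\<close>; the domain property then cancels the power.\<close>
  define h where "h p = c m p - f p * g p" for p
  have h: "h \<in> mpoly L" unfolding h_def using cL m(1) f(1) g by (intro mpoly_diff mpoly.mult)
  have "f p ^ m * h p = 0" if p: "p \<in> C" for p
  proof -
    have "0 = (\<Sum>i\<in>{m..card B}. c i p * f p ^ i)"
      using c(3)[OF p] below p m(1) by (subst sum.mono_neutral_left[of "{..card B}"]) auto
    also have "\<dots> = c m p * f p ^ m + (\<Sum>i\<in>{m<..card B}. c i p * f p ^ i)"
      using m(1) by (simp add: sum.head)
    also have "(\<Sum>i\<in>{m<..card B}. c i p * f p ^ i) =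
        (\<Sum>i\<in>{m<..card B}. f p ^ m * f p * (c i p * f p ^ (i - Suc m)))"
      by (intro sum.cong refl) (auto simp: mult_ac simp flip: power_Suc power_add)
    also have "\<dots> = - (f p ^ m * f p * g p)" by (simp add: g_def sum_distrib_left)
    finally show ?thesis by (auto simp: h_def algebra_simps)
  qed
  moreover have "\<exists>p\<in>C. f p ^ m \<noteq> 0" using f(2) by auto
  ultimately have "\<forall>p\<in>C. h p = 0"
    using domain[of "\<lambda>p. f p ^ m" h] mpoly_mono[OF _ L(2)] mpoly_power f(1) h by metis
  then have "\<forall>p\<in>C. c m p = f p * g p" by (simp add: h_def)
  then show ?thesis using that m(2) g by blast
qed

text \<open>The new generators are the old ones times powers of coordinate \<open>L\<close> below
  \<open>e\<close>; the equation reduces the \<open>e\<close>-th power. Its leading coefficient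
  \<open>D\<close> need not lie in the base ring, but it divides an admissible denominator.\<close>

lemma finite_rank_Suc:
  assumes L: "finite_rank L" "n \<le> L" "L < N" and e: "e > 0"
    and D: "D \<in> mpoly L" "\<exists>p\<in>C. D p \<noteq> 0" and A: "A \<in> mpoly L"
    and eq: "\<forall>p\<in>C. p L ^ e * D p = A p"
  shows "finite_rank (Suc L)"
proof -
  obtain B where B: "finite B" "(\<lambda>p. 1) \<in> frac_span B"
    "\<And>f h. f \<in> mpoly L \<Longrightarrow> h \<in> frac_span B \<Longrightarrow> (\<lambda>p. f p * h p) \<in> frac_span B"
    using L(1) unfolding finite_rank_def by blast
  obtain q g where q: "base_nonzero q" "g \<in> mpoly L" "\<forall>p\<in>C. q p = D p * g p"
    using finite_rank_multiple_in_base[OF L(1) _ D L(2)] L(3) by auto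
  define B' where "B' = (\<lambda>(b, k) p. p L ^ k * b p) ` (B \<times> {..<e})"
  have fin: "finite B'" using B(1) by (simp add: B'_def)
  have pow: "(\<lambda>p. p L ^ k * h p) \<in> frac_span B'" if "k < e" "h \<in> frac_span B" for k h
  proof (rule frac_span_image[OF _ that(2)])
    fix b assume "b \<in> B"
    then have "(\<lambda>p. p L ^ k * b p) \<in> B'" using that(1) unfolding B'_def by force
    then show "(\<lambda>p. p L ^ k * b p) \<in> frac_span B'" using frac_span_base fin by blast
  qed
  show ?thesis
  proof (rule finite_rankI[OF fin])
    show "(\<lambda>p. 1) \<in> frac_span B'" using pow[OF e B(2)] by simp
    fix i b' assume i: "i < Suc L" and "b' \<in> B'"
    then obtain b k where b: "b \<in> B" "k < e" "b' = (\<lambda>p. p L ^ k * b p)" by (auto simp: B'_def)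
    have bs: "b \<in> frac_span B" using b(1) B(1) by (rule frac_span_base[rotated])
    consider "i < L" | "i = L" "Suc k < e" | "i = L" "Suc k = e" using i b(2) by linarith
    then show "(\<lambda>p. p i * b' p) \<in> frac_span B'"
    proof cases
      case 1
      then show ?thesis
        using pow[OF b(2) B(3)[OF mpoly.var[OF 1] bs]] by (simp add: b(3) mult.left_commute)
    next
      case 2
      then show ?thesis using pow[OF 2(2) bs] by (simp add: b(3) mult.assoc)
    next
      \<comment> \<open>The exponent reaches \<open>e\<close>: multiplying by
        \<open>q = D * g\<close> replaces the power by \<open>A * g\<close>, which is free of
        coordinate \<open>L\<close>.\<close>
      case 3
      have "q p * (p L * (p L ^ k * b p)) = A p * g p * b p" if "p \<in> C" for p
      proof -
        have "q p * (p L * (p L ^ k * b p)) = (p L ^ e * D p) * g p * b p"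
          using q(3) that by (simp flip: 3(2))
        then show ?thesis using eq that by simp
      qed
      moreover have "(\<lambda>p. A p * g p * b p) \<in> frac_span B'"
        using pow[OF e B(3)[OF mpoly.mult[OF A q(2)] bs]] by simp
      ultimately show ?thesis using frac_span_divide[OF q(1)] 3(1) by (simp add: b(3))
    qed
  qed
qed

lemma finite_rank_tower:
  assumes tower: "\<And>L. n \<le> L \<Longrightarrow> L < N \<Longrightarrow> \<exists>e D A. e > 0 \<and> D \<in> mpoly L \<and> A \<in> mpoly L \<and>
      (\<exists>p\<in>C. D p \<noteq> 0) \<and> (\<forall>p\<in>C. p L ^ e * D p = A p)"
  shows "finite_rank N"
  using n_le_N
proof (induction rule: dec_induct)
  case base
  show ?case by (rule finite_rank_base)
next
  case (step L)
  obtain e D A where "e > 0" "D \<in> mpoly L" "A \<in> mpoly L" "\<exists>p\<in>C. D p \<noteq> 0"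
    "\<forall>p\<in>C. p L ^ e * D p = A p"
    using tower[OF step(1,2)] by blast
  then show ?case using finite_rank_Suc step by blast
qed

end

section \<open>The incidence variety as a component\<close>

text \<open>Plays the role of the dimension comparison between the two irreducible sets.\<close>

lemma zariski_irreducible_tower_subset_closure:
  fixes P :: "(nat \<Rightarrow> complex) \<Rightarrow> nat \<Rightarrow> complex"
  assumes C: "zariski_irreducible N C" and nN: "n \<le> N"
    and U: "openin (top_of_set (cspace n)) U" "U \<noteq> {}"
    and P: "P ` U \<subseteq> C" "\<And>t i. t \<in> U \<Longrightarrow> i < n \<Longrightarrow> P t i = t i"
    and tower: "\<And>L. n \<le> L \<Longrightarrow> L < N \<Longrightarrow> \<exists>e D A. e > 0 \<and> D \<in> mpoly L \<and> A \<in> mpoly L \<and>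
      (\<exists>p\<in>C. D p \<noteq> 0) \<and> (\<forall>p\<in>C. p L ^ e * D p = A p)"
  shows "C \<subseteq> zariski_closure N (P ` U)"
proof -
  interpret polynomial_domain n N C
  proof
    show "C \<noteq> {}" using C by (simp add: zariski_irreducible_def)
  qed (use nN zariski_irreducible_domain[OF C] in auto)
  have rank: "finite_rank N" using tower by (rule finite_rank_tower)
  have vanish: "\<forall>p\<in>C. f p = 0" if f: "f \<in> mpoly N" "\<And>t. t \<in> U \<Longrightarrow> f (P t) = 0" for f
  proof (rule ccontr)
    assume "\<not> (\<forall>p\<in>C. f p = 0)"
    then obtain q g where q: "base_nonzero q" "\<forall>p\<in>C. q p = f p * g p"
      using finite_rank_multiple_in_base[OF rank order_refl f(1) _ nN] by blast
    have qn: "q \<in> mpoly n" using q(1) by (simp add: base_nonzero_def)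
    have "q t = 0" if "t \<in> U" for t
    proof -
      \<comment> \<open>\<open>q\<close> sees only the T-coordinates, on which \<open>P\<close> is
        the identity.\<close>
      have "q t = q (P t)" by (rule mpoly_cong[OF qn]) (simp add: P(2)[OF that])
      also have "\<dots> = 0" using q(2) P(1) f(2)[OF that] that by auto
      finally show ?thesis .
    qed
    then have "q p = 0" for p using mpoly_eq_zero_if_zero_on_open[OF qn U] by blast
    then show False using q(1) by (simp add: base_nonzero_def)
  qed
  have Cc: "C \<subseteq> cspace N"
    using C by (auto simp: zariski_irreducible_def zariski_closed_def zero_set_def)
  show ?thesis
    unfolding zariski_closure_def
  proof (intro Inter_greatest, clarify)
    fix K p assume K: "zariski_closed N K" "P ` U \<subseteq> K" and p: "p \<in> C"
    obtain F where F: "F \<subseteq> mpoly N" "K = zero_set N F" using K(1) by (auto simp: zariski_closed_def)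
    have "f p = 0" if "f \<in> F" for f
      using vanish[of f] that F K(2) p by (auto simp: zero_set_def)
    then show "p \<in> K" using F(2) p Cc by (auto simp: zero_set_def)
  qed
qed

theorem theorem3p10:
  fixes n m r :: nat and e :: "nat \<Rightarrow> nat"
    and aN aD xN xD \<delta> :: "nat \<Rightarrow> (nat \<Rightarrow> complex) \<Rightarrow> complex"
    and U :: "(nat \<Rightarrow> complex) set"
  assumes "radical_parametrization n m r e aN aD xN xD \<delta> U"
  shows "\<exists>!C. irreducible_component (n + m + r) (auxiliary_variety n m r e aN aD xN xD) C \<and>
              incidence_variety n m r \<delta> xN xD U \<subseteq> C"
proof -
  define N where "N = n + m + r"
  define P where "P = rp_phi n m r \<delta> xN xD"
  define A where "A = auxiliary_variety n m r e aN aD xN xD"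
  define B where "B = zariski_closure N (P ` U)"
  define V where "V = zero_set (N + 1) ({E_poly n e aN aD i | i. i < m} \<union>
    {G_poly n m xN xD j | j. j < r} \<union> {GZ_poly n m r aD xD})"
  define W where "W = (\<lambda>p. p(N := 0)) ` V"
  have A_eq: "A = zariski_closure N W"
    by (simp add: A_def auxiliary_variety_def W_def V_def N_def)
  have e: "e i > 0" and a: "aN i \<in> mpoly (n + i)" "aD i \<in> mpoly (n + i)" if "i < m" for i
    using assms that by (auto simp: radical_parametrization_def)
  have x: "xN j \<in> mpoly (n + m)" "xD j \<in> mpoly (n + m)" if "j < r" for j
    using assms that by (auto simp: radical_parametrization_def)
  have U: "openin (top_of_set (cspace n)) U" "connected U" "U \<noteq> {}" "U \<subseteq> cspace n"
    using assms by (auto simp: radical_parametrization_def)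
  have \<delta>: "holo_on n U (\<delta> i)" if "i < m" for i
    using assms that by (auto simp: radical_parametrization_def)
  have td: "aD i (td_point n m \<delta> t) \<noteq> 0"
    "\<delta> i t ^ e i * aD i (td_point n m \<delta> t) = aN i (td_point n m \<delta> t)" if "t \<in> U" "i < m" for i t
    using assms that by (auto simp: radical_parametrization_def)
  have xD0: "xD j (td_point n m \<delta> t) \<noteq> 0" if "t \<in> U" "j < r" for j t
    using assms that by (auto simp: radical_parametrization_def)

  have P_td: "f (P t) = f (td_point n m \<delta> t)" if "f \<in> mpoly (n + m)" for f t
    using that by (rule mpoly_cong) (simp add: P_def rp_phi_def)
  have a': "aN i \<in> mpoly (n + m)" "aD i \<in> mpoly (n + m)" if "i < m" for i
    using a[OF that] that by (auto elim!: mpoly_mono)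
  have P_cspace: "P ` U \<subseteq> cspace N"
    by (auto simp: P_def rp_phi_def cspace_def N_def td_point_def)
  have P_holo: "holo_on n U (\<lambda>t. P t i)" if "i < N" for i
  proof -
    have hol_td: "holo_on n U (\<lambda>t. td_point n m \<delta> t k)" if "k < n + m" for k
      using that \<delta>[of "k - n"] holo_on_coord by (cases "k < n") (simp_all add: td_point_def)
    show ?thesis
    proof (cases "i < n + m")
      case True
      then show ?thesis using hol_td by (simp add: P_def rp_phi_def)
    next
      case False
      define j where "j = i - (n + m)"
      have j: "j < r" using False that by (simp add: j_def N_def)
      have "holo_on n U (\<lambda>t. xN j (td_point n m \<delta> t) / xD j (td_point n m \<delta> t))"
        using holo_on_mpoly[OF x(1)[OF j] hol_td] holo_on_mpoly[OF x(2)[OF j] hol_td] xD0[OF _ j]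
        by (rule holo_on_divide)
      then show ?thesis using False that by (simp add: P_def rp_phi_def rp_x_def N_def j_def)
    qed
  qed

  have P_W: "P t \<in> W" if t: "t \<in> U" for t
  proof -
    \<comment> \<open>All denominators are nonzero along the branch, so \<open>1 / d\<close> is the
      value of \<open>Z\<close> that lifts \<open>P t\<close> to a point of
      \<open>V\<close>.\<close>
    define d where "d = (\<Prod>j<r. xD j (P t)) * (\<Prod>i<m. aD i (P t))"
    have d: "d \<noteq> 0" using xD0[OF t] td[OF t] by (simp add: d_def P_td x a')
    define p where "p = (P t)(N := 1 / d)"
    have eq: "f p = f (P t)" if "f \<in> mpoly (n + m)" for f
      using that by (rule mpoly_cong) (simp add: p_def N_def)
    have "p \<in> V"
      unfolding V_def zero_set_def
    proof (intro CollectI conjI ballI)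
      show "p \<in> cspace (N + 1)" using P_cspace t by (auto simp: p_def cspace_def)
      fix f assume "f \<in> {E_poly n e aN aD i | i. i < m} \<union> {G_poly n m xN xD j | j. j < r} \<union>
        {GZ_poly n m r aD xD}"
      then consider i where "i < m" "f = E_poly n e aN aD i" | j where "j < r" "f = G_poly n m xN xD j"
        | "f = GZ_poly n m r aD xD" by blast
      then show "f p = 0"
      proof cases
        case 1
        moreover have "p (n + i) = \<delta> i t"
          using 1 by (simp add: p_def N_def P_def rp_phi_def td_point_def)
        ultimately show ?thesis using td(2)[OF t] by (simp add: E_poly_def eq a' P_td)
      next
        case 2
        moreover have "p (n + m + j) = rp_x n m \<delta> xN xD j t"
          using 2 by (simp add: p_def N_def P_def rp_phi_def)
        ultimately show ?thesis using xD0[OF t] by (simp add: G_poly_def eq x P_td rp_x_def)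
      next
        case 3
        have "(\<Prod>j<r. xD j p) * (\<Prod>i<m. aD i p) = d" by (simp add: d_def eq x a')
        then show ?thesis using 3 d by (simp add: GZ_poly_def p_def N_def)
      qed
    qed
    have "P t N = 0" using P_cspace t by (auto simp: cspace_def)
    then have "P t = p(N := 0)" by (simp add: p_def fun_upd_idem)
    with \<open>p \<in> V\<close> show ?thesis by (auto simp: W_def)
  qed

  have W_cspace: "W \<subseteq> cspace N"
    by (auto simp: W_def V_def zero_set_def cspace_def)
  \<comment> \<open>A polynomial not involving \<open>Z\<close> keeps its value under the
    projection, so it vanishes on \<open>W\<close> and hence on the closure
    \<open>A\<close>.\<close>
  have eqs: "\<forall>p\<in>A. f p = 0" if f: "f \<in> mpoly N" "\<And>p. p \<in> V \<Longrightarrow> f p = 0" for f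
  proof -
    have "f (p(N := 0)) = f p" for p using f(1) by (rule mpoly_cong) simp
    then have "W \<subseteq> zero_set N {f}" using W_cspace f(2) by (auto simp: zero_set_def W_def)
    then have "A \<subseteq> zero_set N {f}"
      unfolding A_eq using f(1) by (intro zariski_closure_minimal zariski_closed_zero_set) auto
    then show ?thesis by (auto simp: zero_set_def)
  qed
  have E: "p (n + i) ^ e i * aD i p = aN i p" if "p \<in> A" "i < m" for p i
  proof -
    have "E_poly n e aN aD i \<in> mpoly N"
      unfolding E_poly_def[abs_def] using a[OF that(2)] that(2)
      by (intro mpoly_diff mpoly.mult mpoly_power mpoly.var) (auto simp: N_def elim!: mpoly_mono)
    moreover have "E_poly n e aN aD i p = 0" if "p \<in> V" for p
      using that \<open>i < m\<close> unfolding V_def zero_set_def by blast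
    ultimately have "E_poly n e aN aD i p = 0" using eqs that(1) by blast
    then show ?thesis by (simp add: E_poly_def)
  qed
  have G: "p (n + m + j) * xD j p = xN j p" if "p \<in> A" "j < r" for p j
  proof -
    have "G_poly n m xN xD j \<in> mpoly N"
      unfolding G_poly_def[abs_def] using x[OF that(2)] that(2)
      by (intro mpoly_diff mpoly.mult mpoly.var) (auto simp: N_def elim!: mpoly_mono)
    moreover have "G_poly n m xN xD j p = 0" if "p \<in> V" for p
      using that \<open>j < r\<close> unfolding V_def zero_set_def by blast
    ultimately have "G_poly n m xN xD j p = 0" using eqs that(1) by blast
    then show ?thesis by (simp add: G_poly_def)
  qed

  have B_irr: "zariski_irreducible N B"
    unfolding B_def using U(1-3) P_cspace P_holo by (rule zariski_irreducible_closure_holo_image)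
  have B_A: "B \<subseteq> A"
    unfolding B_def A_eq using P_W by (intro zariski_closure_mono) auto
  \<comment> \<open>Serves twice: it makes \<open>B\<close> maximal among the irreducible closed
    subsets of \<open>A\<close>, and it identifies every component containing \<open>B\<close> with
    \<open>B\<close>.\<close>
  have max: "C = B" if C: "zariski_irreducible N C" "B \<subseteq> C" "C \<subseteq> A" for C
  proof
    have PC: "P ` U \<subseteq> C" using C(2) zariski_closure_subset unfolding B_def by blast
    obtain t where t: "t \<in> U" using U(3) by auto
    show "C \<subseteq> B"
      unfolding B_def
    \<comment> \<open>A Delta-coordinate satisfies its \<open>E\<close> equation with exponent
      \<open>e i\<close>, an X-coordinate its \<open>G\<close> equation with exponent 1. The
      denominators are nonzero at \<open>P t\<close>, a point of \<open>C\<close>.\<close>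
    proof (rule zariski_irreducible_tower_subset_closure[OF C(1) _ U(1,3) PC])
      fix L assume L: "n \<le> L" "L < N"
      show "\<exists>e D A. e > 0 \<and> D \<in> mpoly L \<and> A \<in> mpoly L \<and> (\<exists>p\<in>C. D p \<noteq> 0) \<and>
          (\<forall>p\<in>C. p L ^ e * D p = A p)"
      proof (cases "L < n + m")
        case True
        define i where "i = L - n"
        have i: "i < m" "L = n + i" using True L by (auto simp: i_def)
        have "aD i (P t) \<noteq> 0" using td(1)[OF t i(1)] by (simp add: P_td[OF a'(2)[OF i(1)]])
        then show ?thesis
          using e[OF i(1)] a[OF i(1)] E[OF _ i(1)] C(3) PC t unfolding i(2)
          by (intro exI[of _ "e i"] exI[of _ "aD i"] exI[of _ "aN i"]) auto
      next
        case False
        define j where "j = L - (n + m)"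
        have j: "j < r" "L = n + m + j" using False L by (auto simp: j_def N_def)
        have "xD j (P t) \<noteq> 0" using xD0[OF t j(1)] by (simp add: P_td[OF x(2)[OF j(1)]])
        moreover have "xN j \<in> mpoly L" "xD j \<in> mpoly L"
          using x[OF j(1)] j(2) by (auto elim!: mpoly_mono)
        ultimately show ?thesis
          using G[OF _ j(1)] C(3) PC t unfolding j(2)
          by (intro exI[of _ 1] exI[of _ "xD j"] exI[of _ "xN j"]) auto
      qed
    qed (auto simp: N_def P_def rp_phi_def td_point_def)
  qed (rule C(2))
  have "\<exists>!C. irreducible_component N A C \<and> B \<subseteq> C"
  proof (rule ex1I[of _ B])
    show "irreducible_component N A B \<and> B \<subseteq> B"
      using B_irr B_A max by (auto simp: irreducible_component_def)
    show "C = B" if "irreducible_component N A C \<and> B \<subseteq> C" for C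
      using that max by (auto simp: irreducible_component_def)
  qed
  then show ?thesis by (simp add: N_def A_def B_def P_def incidence_variety_def)
qed

end
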